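(* Let $X$ be a real Hilbert space. Assume that $L:X\to2^X$ is single-valued, invertible, strictly monotone and maximal monotone. If $Q:X\to2^X$ is monotone, satisfies $Q(x)\neq\emptyset$ for all $x\in X$, and $$LQL=Q^{-1},$$ then $Q=L^{-1}$. In other words, the equation $LQL=Q^{-1}$ has a unique solution $Q$ in the set $$\Omega(X):=\{Q:X\to2^X:\ Q(x)\neq\emptyset\ \ \forall x\in X\ \text{ and } Q \text{ is monotone}\},$$ and this solution is $Q=L^{-1}$.
   Context: $2^X$ is the set of all subsets of $X$. A set-valued operator $A:X\to2^X$ is identified with its graph $G(A)=\{(x,y)\in X^2:y\in Ax\}$; $A\subseteq B$ means $G(A)\subseteq G(B)$. $A$ is single-valued if $Ax$ is a singleton for every $x\in X$; it is then regarded as a function $X\to X$, and invertible means that this function is a bijection. Composition: $(BA)(x):=\bigcup_{x'\in Ax}Bx'$. The inverse $A^{-1}$ is the set-valued operator with graph $\{(y,x):y\in Ax\}$. $A$ is monotone if $\langle y_2-y_1,x_2-x_1\rangle\ge0$ for all $x_1,x_2\in X$ and all $y_i\in Ax_i$, $i=1,2$; strictly monotone if this inequality is strict whenever $x_1\neq x_2$; maximal monotone if it is monotone and there is no monotone $B:X\to2^X$ with $A\subseteq B$ and $A\neq B$. *)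

theory Defs
  imports "HOL-Analysis.Analysis"
begin

text \<open>A real Hilbert space is a type of sort \<open>{real_inner, complete_space}\<close>.\<close>

type_synonym 'a set_op = "'a \<Rightarrow> 'a set"

definition op_graph :: "'a set_op \<Rightarrow> ('a \<times> 'a) set"
  where "op_graph A = {(x, y). y \<in> A x}"

definition op_single_valued :: "'a set_op \<Rightarrow> bool"
  where "op_single_valued A \<longleftrightarrow> (\<forall>x. \<exists>y. A x = {y})"

text \<open>Only meaningful for single-valued operators, since \<open>the_elem\<close> is
  unspecified on sets that are not singletons.\<close>

definition op_fun :: "'a set_op \<Rightarrow> 'a \<Rightarrow> 'a"
  where "op_fun A x = the_elem (A x)"

definition op_invertible :: "'a set_op \<Rightarrow> bool"
  where "op_invertible A \<longleftrightarrow> op_single_valued A \<and> bij (op_fun A)"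

definition op_comp :: "'a set_op \<Rightarrow> 'a set_op \<Rightarrow> 'a set_op"  (infixr "\<circ>\<^sub>s" 75)
  where "(B \<circ>\<^sub>s A) x = (\<Union>x'\<in>A x. B x')"

definition op_inverse :: "'a set_op \<Rightarrow> 'a set_op"
  where "op_inverse A y = {x. y \<in> A x}"

lemma op_graph_op_inverse: "op_graph (op_inverse A) = {(y, x). y \<in> A x}"
  by (simp add: op_graph_def op_inverse_def)

definition op_monotone :: "'a::real_inner set_op \<Rightarrow> bool"
  where "op_monotone A \<longleftrightarrow>
    (\<forall>x1 x2. \<forall>y1\<in>A x1. \<forall>y2\<in>A x2. inner (y2 - y1) (x2 - x1) \<ge> 0)"

definition op_strictly_monotone :: "'a::real_inner set_op \<Rightarrow> bool"
  where "op_strictly_monotone A \<longleftrightarrow> op_monotone A \<and>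
    (\<forall>x1 x2. \<forall>y1\<in>A x1. \<forall>y2\<in>A x2. x1 \<noteq> x2 \<longrightarrow> inner (y2 - y1) (x2 - x1) > 0)"

definition op_maximal_monotone :: "'a::real_inner set_op \<Rightarrow> bool"
  where "op_maximal_monotone A \<longleftrightarrow> op_monotone A \<and>
    \<not> (\<exists>B. op_monotone B \<and> op_graph A \<subseteq> op_graph B \<and> A \<noteq> B)"

definition Omega :: "'a::real_inner set_op set"
  where "Omega = {Q. (\<forall>x. Q x \<noteq> {}) \<and> op_monotone Q}"

end

theory Submission
  imports Defs
begin

text \<open>
  Write \<open>L x = {f x}\<close> with \<open>f\<close> a bijection. The equation \<open>LQL = Q\<^sup>-\<^sup>1\<close> makes the relation
  \<open>z \<in> Q (f x)\<close> symmetric in \<open>x\<close> and \<open>z\<close>. So \<open>z \<in> Q (f x)\<close> gives \<open>x \<in> Q (f z)\<close>, and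
  monotonicity of \<open>Q\<close> yields \<open>\<langle>x - z, f z - f x\<rangle> \<ge> 0\<close>, which strict monotonicity of \<open>f\<close>
  permits only for \<open>z = x\<close>. Hence \<open>Q (f x) = {x}\<close>, and surjectivity of \<open>f\<close> determines \<open>Q\<close>.
\<close>

text \<open>Trades \<open>the_elem\<close> for a plain bijection \<open>f\<close>, so that
  membership in compositions and inverses simplifies to equations in \<open>f\<close>.\<close>

lemma op_invertibleE:
  assumes "op_invertible L"
  obtains f where "bij f" "L = (\<lambda>x. {f x})"
proof
  show "bij (op_fun L)"
    using assms by (simp add: op_invertible_def)
  have "L x = {op_fun L x}" for x
  proof -
    obtain y where "L x = {y}"
      using assms unfolding op_invertible_def op_single_valued_def by blast
    then show ?thesis by (simp add: op_fun_def)
  qed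
  then show "L = (\<lambda>x. {op_fun L x})" by blast
qed

lemma op_inverse_op_inverse: "op_inverse (op_inverse A) = A"
  by (auto simp: op_inverse_def fun_eq_iff)

lemma op_monotone_op_inverse:
  assumes "op_monotone A"
  shows "op_monotone (op_inverse A)"
  using assms unfolding op_monotone_def op_inverse_def by (simp, metis inner_commute)

text \<open>Existence half: since inverting twice gives back \<open>L\<close>, this says that
  \<open>op_inverse L\<close> solves the equation.\<close>

lemma op_comp_op_inverse_self:
  assumes "op_invertible L"
  shows "L \<circ>\<^sub>s op_inverse L \<circ>\<^sub>s L = L"
proof -
  obtain f where "bij f" and L: "L = (\<lambda>x. {f x})"
    using assms by (rule op_invertibleE)
  then show ?thesis
    by (auto simp: L op_comp_def op_inverse_def fun_eq_iff)
qed

lemma op_inverse_in_Omega: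
  assumes "op_invertible L" "op_monotone L"
  shows "op_inverse L \<in> Omega"
proof -
  obtain f where f: "bij f" and L: "L = (\<lambda>x. {f x})"
    using assms(1) by (rule op_invertibleE)
  have "op_inverse L x \<noteq> {}" for x
    using bij_is_surj[OF f] by (auto simp: L op_inverse_def surj_def)
  then show ?thesis
    using op_monotone_op_inverse[OF assms(2)] by (simp add: Omega_def)
qed

lemma solution_eq_op_inverse:
  assumes inv: "op_invertible L" and strict: "op_strictly_monotone L"
    and mono: "op_monotone Q" and nonempty: "\<And>x. Q x \<noteq> {}"
    and eq: "L \<circ>\<^sub>s Q \<circ>\<^sub>s L = op_inverse Q"
  shows "Q = op_inverse L"
proof -
  obtain f where f: "bij f" and L: "L = (\<lambda>x. {f x})"
    using inv by (rule op_invertibleE)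
  have sym: "x \<in> Q (f z)" if "z \<in> Q (f x)" for x z
  proof -
    \<comment> \<open>By \<open>eq\<close>, this membership reads
      \<open>f z \<in> op_inverse Q x\<close>, which is the claim.\<close>
    have "f z \<in> (L \<circ>\<^sub>s Q \<circ>\<^sub>s L) x"
      using that by (auto simp: L op_comp_def)
    then show ?thesis
      by (simp add: eq op_inverse_def)
  qed
  have only: "z = x" if z: "z \<in> Q (f x)" for x z
  proof (rule ccontr)
    assume "z \<noteq> x"
    then have "inner (f z - f x) (z - x) > 0"
      using strict by (auto simp: op_strictly_monotone_def L)
    \<comment> \<open>Monotonicity of \<open>Q\<close> at the graph points \<open>(f x, z)\<close>
      and \<open>(f z, x)\<close>; the left side is the negative of the inner product above.\<close>
    moreover have "inner (x - z) (f z - f x) \<ge> 0"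
      using mono z sym[OF z] by (auto simp: op_monotone_def)
    ultimately show False
      by (simp add: inner_commute inner_diff_right)
  qed
  \<comment> \<open>\<open>only\<close> bounds the value by \<open>{x}\<close>; nonemptiness
    excludes the empty set.\<close>
  have Qf: "Q (f x) = {x}" for x
    using only nonempty[of "f x"] by blast
  have "Q y = op_inverse L y" for y
  proof -
    obtain x where "y = f x"
      using bij_is_surj[OF f] by (auto simp: surj_def)
    then show ?thesis
      using Qf bij_is_inj[OF f] by (auto simp: op_inverse_def L inj_eq)
  qed
  then show ?thesis by blast
qed

theorem lemma6p2:
  fixes L :: "'a::{real_inner, complete_space} set_op"
  assumes "op_single_valued L"
    and "op_invertible L"
    and "op_strictly_monotone L"
    and "op_maximal_monotone L"
  shows "(\<forall>Q. op_monotone Q \<longrightarrow> (\<forall>x. Q x \<noteq> {}) \<longrightarrow> L \<circ>\<^sub>s Q \<circ>\<^sub>s L = op_inverse Q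
             \<longrightarrow> Q = op_inverse L)
    \<and> (\<exists>!Q. Q \<in> Omega \<and> L \<circ>\<^sub>s Q \<circ>\<^sub>s L = op_inverse Q)
    \<and> op_inverse L \<in> Omega
    \<and> L \<circ>\<^sub>s op_inverse L \<circ>\<^sub>s L = op_inverse (op_inverse L)"
proof -
  have unique: "Q = op_inverse L"
    if "op_monotone Q" "\<forall>x. Q x \<noteq> {}" "L \<circ>\<^sub>s Q \<circ>\<^sub>s L = op_inverse Q" for Q
    using solution_eq_op_inverse[OF assms(2,3)] that by blast
  have Omega: "op_inverse L \<in> Omega"
    using op_inverse_in_Omega assms(2,3) by (auto simp: op_strictly_monotone_def)
  have sol: "L \<circ>\<^sub>s op_inverse L \<circ>\<^sub>s L = op_inverse (op_inverse L)"
    using op_comp_op_inverse_self[OF assms(2)] by (simp add: op_inverse_op_inverse)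
  have "\<exists>!Q. Q \<in> Omega \<and> L \<circ>\<^sub>s Q \<circ>\<^sub>s L = op_inverse Q"
  proof (rule ex1I)
    show "op_inverse L \<in> Omega \<and> L \<circ>\<^sub>s op_inverse L \<circ>\<^sub>s L = op_inverse (op_inverse L)"
      using Omega sol by blast
    show "Q = op_inverse L" if "Q \<in> Omega \<and> L \<circ>\<^sub>s Q \<circ>\<^sub>s L = op_inverse Q" for Q
      using that unique by (simp add: Omega_def)
  qed
  with unique Omega sol show ?thesis by blast
qed

end
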